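(* Let $R$ be a ring. Then $R$ is a reduced ring if and only if every N-pure ideal of $R$ is a pure ideal.
   Context: All rings are commutative with identity. $\mathfrak{N}$ denotes the nil-radical of $R$. An ideal $I$ of $R$ is called pure if for each $a\in I$ there exists $b\in I$ such that $a(1-b)=0$. An ideal $I$ of $R$ is called N-pure if for every $a\in I$ there exists $b\in I$ such that $a(1-b)\in\mathfrak{N}$. *)

theory Defs
  imports "HOL-Algebra.Ideal"
begin

(* The exponent 0 is harmless: it forces 1 = 0, i.e. the zero ring, whose only element is 0. *)
definition nilpotent_elem :: "('a, 'b) ring_scheme \<Rightarrow> 'a \<Rightarrow> bool" where
  "nilpotent_elem R x \<longleftrightarrow> x \<in> carrier R \<and> (\<exists>n::nat. x [^]\<^bsub>R\<^esub> n = \<zero>\<^bsub>R\<^esub>)"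

definition nilradical :: "('a, 'b) ring_scheme \<Rightarrow> 'a set" where
  "nilradical R = {x. nilpotent_elem R x}"

definition reduced_ring :: "('a, 'b) ring_scheme \<Rightarrow> bool" where
  "reduced_ring R \<longleftrightarrow> cring R \<and> (\<forall>x. nilpotent_elem R x \<longrightarrow> x = \<zero>\<^bsub>R\<^esub>)"

definition pure_ideal :: "'a set \<Rightarrow> ('a, 'b) ring_scheme \<Rightarrow> bool" where
  "pure_ideal I R \<longleftrightarrow> ideal I R \<and>
     (\<forall>a\<in>I. \<exists>b\<in>I. a \<otimes>\<^bsub>R\<^esub> (\<one>\<^bsub>R\<^esub> \<ominus>\<^bsub>R\<^esub> b) = \<zero>\<^bsub>R\<^esub>)"

definition N_pure_ideal :: "'a set \<Rightarrow> ('a, 'b) ring_scheme \<Rightarrow> bool" where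
  "N_pure_ideal I R \<longleftrightarrow> ideal I R \<and>
     (\<forall>a\<in>I. \<exists>b\<in>I. a \<otimes>\<^bsub>R\<^esub> (\<one>\<^bsub>R\<^esub> \<ominus>\<^bsub>R\<^esub> b) \<in> nilradical R)"

end

(* If every N-pure ideal is pure and x is nilpotent, then all elements of the principal ideal (x)
   are nilpotent, so (x) is N-pure (take b = 0) and hence pure. Thus x = x b for some b in (x),
   and iterating gives x = x b^n = 0 because b is nilpotent. *)
theory Submission
  imports Defs
begin

context cring
begin

lemma nilpotent_elem_mult_left:
  assumes "nilpotent_elem R x" "r \<in> carrier R"
  shows "nilpotent_elem R (r \<otimes> x)"
proof -
  obtain n :: nat where "x \<in> carrier R" "x [^] n = \<zero>"
    using assms(1) unfolding nilpotent_elem_def by blast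
  \<comment> \<open>Commutativity splits the power as \<open>r [^] n \<otimes> x [^] n\<close>, so
    the exponent that kills \<open>x\<close> also works here.\<close>
  moreover from this have "(r \<otimes> x) [^] n = \<zero>"
    using assms(2) by (simp add: nat_pow_distrib)
  ultimately show ?thesis
    using assms(2) unfolding nilpotent_elem_def by blast
qed

lemma eq_zero_if_fixed_by_nilpotent:
  assumes "nilpotent_elem R b" "x \<in> carrier R" "x \<otimes> b = x"
  shows "x = \<zero>"
proof -
  obtain n :: nat where b: "b \<in> carrier R" "b [^] n = \<zero>"
    using assms(1) unfolding nilpotent_elem_def by blast
  have "x \<otimes> b [^] k = x" for k :: nat
  proof (induction k)
    case (Suc k)
    then show ?case
      using assms(2,3) b(1) m_assoc[of x "b [^] k" b] by simp
  qed (use assms(2) in simp)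
  from this[of n] show ?thesis
    using assms(2) b by simp
qed

text \<open>Turns the purity condition into the fixed-point form \<open>a \<otimes> b = a\<close>,
  which can be iterated.\<close>

lemma mult_one_minus_eq_zero_iff:
  assumes "a \<in> carrier R" "b \<in> carrier R"
  shows "a \<otimes> (\<one> \<ominus> b) = \<zero> \<longleftrightarrow> a \<otimes> b = a"
proof -
  have "a \<otimes> (\<one> \<ominus> b) = a \<ominus> a \<otimes> b"
    using assms by (simp add: a_minus_def r_distr r_minus)
  then show ?thesis
    using assms by (metis a_inv_closed m_closed minus_eq minus_minus r_neg sum_zero_eq_neg)
qed

text \<open>The witness \<open>\<zero>\<close> serves every \<open>a\<close>, since
  \<open>a \<otimes> (\<one> \<ominus> \<zero>)\<close> is \<open>a\<close>, already
  nilpotent.\<close>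

lemma N_pure_ideal_if_nil:
  assumes "ideal I R" "I \<subseteq> nilradical R"
  shows "N_pure_ideal I R"
proof -
  have "a \<otimes> (\<one> \<ominus> \<zero>) \<in> nilradical R" if "a \<in> I" for a
    using that assms ideal.Icarr[OF assms(1) that] by (auto simp: a_minus_def)
  moreover have "\<zero> \<in> I"
    using assms(1) by (simp add: additive_subgroup.zero_closed ideal.axioms(1))
  ultimately show ?thesis
    using assms(1) unfolding N_pure_ideal_def by blast
qed

text \<open>Purity supplies some \<open>b\<close> in \<open>I\<close> that fixes \<open>x\<close>;
  as a member of \<open>I\<close> this \<open>b\<close> is nilpotent, which forces \<open>x\<close>
  to vanish.\<close>

lemma pure_nil_ideal_eq_zero:
  assumes "pure_ideal I R" "I \<subseteq> nilradical R" "x \<in> I"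
  shows "x = \<zero>"
proof -
  obtain b where b: "b \<in> I" "x \<otimes> (\<one> \<ominus> b) = \<zero>"
    using assms(1,3) unfolding pure_ideal_def by blast
  have carr: "x \<in> carrier R" "b \<in> carrier R"
    using assms(1,3) b(1) ideal.Icarr unfolding pure_ideal_def by fast+
  moreover have "nilpotent_elem R b"
    using assms(2) b(1) unfolding nilradical_def by blast
  ultimately show ?thesis
    using b(2) eq_zero_if_fixed_by_nilpotent by (simp add: mult_one_minus_eq_zero_iff)
qed

end

theorem proposition2p3:
  fixes R :: "('a, 'b) ring_scheme"
  assumes "cring R"
  shows "reduced_ring R \<longleftrightarrow> (\<forall>I. N_pure_ideal I R \<longrightarrow> pure_ideal I R)"
proof -
  interpret cring R by fact
  show ?thesis
  proof
    assume "reduced_ring R"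
    \<comment> \<open>Once the nilradical is trivial, membership in it means being zero, so the
      N-pure condition yields the pure one with the same \<open>b\<close>.\<close>
    then have "a = \<zero>\<^bsub>R\<^esub>" if "a \<in> nilradical R" for a
      using that unfolding reduced_ring_def nilradical_def by blast
    then show "\<forall>I. N_pure_ideal I R \<longrightarrow> pure_ideal I R"
      unfolding N_pure_ideal_def pure_ideal_def by blast
  next
    assume pure: "\<forall>I. N_pure_ideal I R \<longrightarrow> pure_ideal I R"
    have "x = \<zero>\<^bsub>R\<^esub>" if x: "nilpotent_elem R x" for x
    proof (rule pure_nil_ideal_eq_zero)
      have carr: "x \<in> carrier R"
        using x unfolding nilpotent_elem_def by blast
      \<comment> \<open>By definition the principal ideal consists of the single multiples
        \<open>r \<otimes> x\<close>, so closure of nilpotents under multiplication suffices and no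
        sums arise.\<close>
      show nil: "PIdl\<^bsub>R\<^esub> x \<subseteq> nilradical R"
        using nilpotent_elem_mult_left[OF x] unfolding cgenideal_def nilradical_def by blast
      show "pure_ideal (PIdl\<^bsub>R\<^esub> x) R"
        using pure N_pure_ideal_if_nil[OF cgenideal_ideal[OF carr] nil] by blast
      show "x \<in> PIdl\<^bsub>R\<^esub> x"
        using carr by (rule cgenideal_self)
    qed
    then show "reduced_ring R"
      using assms unfolding reduced_ring_def by blast
  qed
qed

end
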